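(* For every positive integer $n$ one has $$g(n)\le \lfloor \sqrt{n}\rfloor,$$ where $g(n)$ denotes the infimum of all real numbers $L\ge 0$ for which there exists a multiplicative Sidon set $A\subseteq\{1,2,\dots,n\}$ satisfying $A\cap[x,x+L]\neq\varnothing$ for every $x\in\mathbb{R}$ with $[x,x+L]\subseteq[1,n]$.
   Context: A set $A$ of positive integers is called a multiplicative Sidon set if all products $aa'$ with $a,a'\in A$ and $a\le a'$ are distinct; that is, if $a_1a_2=a_3a_4$ with $a_1,a_2,a_3,a_4\in A$, $a_1\le a_2$ and $a_3\le a_4$, then $a_1=a_3$ and $a_2=a_4$. In the definition of $g(n)$, $[x,x+L]$ and $[1,n]$ are closed intervals of real numbers. *)

theory Defs
  imports Complex_Main
begin

definition mult_sidon :: "nat set \<Rightarrow> bool" where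
  "mult_sidon A \<longleftrightarrow> (\<forall>a\<in>A. 0 < a) \<and>
     (\<forall>a1\<in>A. \<forall>a2\<in>A. \<forall>a3\<in>A. \<forall>a4\<in>A.
        a1 \<le> a2 \<longrightarrow> a3 \<le> a4 \<longrightarrow> a1 * a2 = a3 * a4 \<longrightarrow> a1 = a3 \<and> a2 = a4)"

(* The set of admissible L is bounded below by 0 and contains n (for L > n - 1 the covering
   condition is vacuous), so Inf is a genuine infimum of reals here. *)
definition g :: "nat \<Rightarrow> real" where
  "g n = Inf {L::real. 0 \<le> L \<and>
     (\<exists>A. mult_sidon A \<and> A \<subseteq> {1..n} \<and>
        (\<forall>x::real. {x..x + L} \<subseteq> {1..real n} \<longrightarrow> real ` A \<inter> {x..x + L} \<noteq> {}))}"

end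

theory Submission
  imports Defs
begin

text \<open>
  With \<open>s = \<lfloor>sqrt n\<rfloor>\<close>, the progression of all \<open>k * s + 1 \<le> n\<close> has gaps exactly \<open>s\<close>, and
  \<open>n < (s + 1)\<^sup>2\<close> forces \<open>k \<le> s + 1\<close>. Expanding \<open>(i s + 1)(j s + 1) = (k s + 1)(l s + 1)\<close> gives
  \<open>s (k l - i j) = (i + j) - (k + l)\<close>. If the sums of the indices differed, the pair with the
  larger sum would have the smaller product, and the ranges of the indices rule this out; so both
  the sums and the products of the indices agree.
\<close>

text \<open>If the sum on the left were larger, passing to the complementary indices
  \<open>s + 1 - i\<close> and \<open>s + 1 - j\<close>, which are nonnegative, would make their
  product negative.\<close>

lemma progression_product_index_sum_le:
  fixes s i j k l :: int
  assumes s: "s \<ge> 1"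
    and range: "i \<le> s + 1" "j \<le> s + 1" "0 \<le> k" "k \<le> s + 1" "0 \<le> l" "l \<le> s + 1"
    and nonneg: "0 \<le> i" "0 \<le> j"
    and eq: "(i * s + 1) * (j * s + 1) = (k * s + 1) * (l * s + 1)"
  shows "i + j \<le> k + l"
proof (rule ccontr)
  assume gt: "\<not> i + j \<le> k + l"
  define D where "D = k * l - i * j"
  have "s * (s * D) = s * (i + j - (k + l))"
    using eq unfolding D_def by (simp add: algebra_simps)
  then have sD: "i + j = k + l + s * D"
    using s by auto
  with gt have "s * D > 0" by simp
  then have D: "D \<ge> 1"
    using s by (simp add: zero_less_mult_iff)
  \<comment> \<open>Positive \<open>k\<close> and \<open>l\<close> give the bound
    \<open>s * s\<close> for \<open>(s + 1 - k) * (s + 1 - l)\<close>; the bound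
    \<open>(s + 1)^2\<close> from \<open>k, l \<ge> 0\<close> would exceed
    \<open>s^2 + s + 1\<close> and yield no contradiction.\<close>
  have "k * l > 0"
    using D mult_nonneg_nonneg[OF nonneg] unfolding D_def by linarith
  then have kl: "k \<ge> 1" "l \<ge> 1"
    using range by (auto simp: zero_less_mult_iff)
  have "(s + 1 - i) * (s + 1 - j) = (s + 1)\<^sup>2 - (s + 1) * (i + j) + i * j"
    by (simp add: algebra_simps power2_eq_square)
  also have "\<dots> = (s + 1 - k) * (s + 1 - l) - D * (s\<^sup>2 + s + 1)"
    unfolding sD by (simp add: D_def algebra_simps power2_eq_square)
  also have "(s + 1 - k) * (s + 1 - l) \<le> s * s"
    using kl range s by (intro mult_mono) auto
  also have "s * s - D * (s\<^sup>2 + s + 1) < 0"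
  proof -
    have "1 * (s\<^sup>2 + s + 1) \<le> D * (s\<^sup>2 + s + 1)"
      using D s by (intro mult_right_mono) auto
    then show ?thesis using s by (simp only: power2_eq_square mult_1)
  qed
  finally have "(s + 1 - i) * (s + 1 - j) < 0" by simp
  moreover have "(s + 1 - i) * (s + 1 - j) \<ge> 0"
    using range by simp
  ultimately show False by simp
qed

text \<open>Vieta: \<open>i\<close> is a root of \<open>(X - k) * (X - l)\<close>, and the ordering
  settles which one.\<close>

lemma eq_if_sum_eq_prod_eq:
  fixes i j k l :: "'a :: linordered_idom"
  assumes "i + j = k + l" "i * j = k * l" "i \<le> j" "k \<le> l"
  shows "i = k \<and> j = l"
proof -
  have "(i - k) * (i - l) = i * i - i * (k + l) + k * l"
    by (simp add: algebra_simps)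
  also have "\<dots> = 0"
    unfolding assms(1,2)[symmetric] by (simp add: algebra_simps)
  finally have "i = k \<or> i = l" by simp
  then show ?thesis using assms by auto
qed

lemma progression_mult_sidon:
  fixes s n :: nat
  assumes s: "s \<ge> 1" and n: "n < (s + 1)\<^sup>2"
  shows "mult_sidon {a. a \<le> n \<and> (\<exists>k. a = k * s + 1)}"
proof -
  \<comment> \<open>The index \<open>s + 2\<close> already gives the term
    \<open>(s + 2) * s + 1 = (s + 1)^2\<close>, which exceeds \<open>n\<close>.\<close>
  have index: "k \<le> s + 1" if "k * s + 1 \<le> n" for k
  proof (rule ccontr)
    assume "\<not> k \<le> s + 1"
    then have "(s + 2) * s \<le> k * s" by (intro mult_right_mono) auto
    with that n show False by (simp add: power2_eq_square)
  qed
  have "i * s + 1 = k * s + 1 \<and> j * s + 1 = l * s + 1"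
    if le: "i * s + 1 \<le> n" "j * s + 1 \<le> n" "k * s + 1 \<le> n" "l * s + 1 \<le> n"
      and ord: "i * s + 1 \<le> j * s + 1" "k * s + 1 \<le> l * s + 1"
      and eq: "(i * s + 1) * (j * s + 1) = (k * s + 1) * (l * s + 1)" for i j k l
  proof -
    have bounds: "int i \<le> int s + 1" "int j \<le> int s + 1" "int k \<le> int s + 1" "int l \<le> int s + 1"
      using le[THEN index] by auto
    have eq': "(int i * int s + 1) * (int j * int s + 1) = (int k * int s + 1) * (int l * int s + 1)"
      using arg_cong[OF eq, of int] by (simp add: algebra_simps)
    \<comment> \<open>The inequality applies in both directions, with the two pairs
      exchanged.\<close>
    have "int i + int j = int k + int l"
      using progression_product_index_sum_le[of "int s" "int i" "int j" "int k" "int l"]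
        progression_product_index_sum_le[of "int s" "int k" "int l" "int i" "int j"]
        bounds s eq' by auto
    then have sum: "i + j = k + l" by linarith
    have "s * s * (i * j) + s * (i + j) = s * s * (k * l) + s * (k + l)"
      using eq by (simp add: algebra_simps)
    then have "i * j = k * l" unfolding sum using s by simp
    moreover have "i \<le> j" "k \<le> l" using ord s by auto
    ultimately have "int i = int k \<and> int j = int l"
      using sum by (intro eq_if_sum_eq_prod_eq) (auto simp flip: of_nat_add of_nat_mult)
    then show ?thesis by simp
  qed
  then show ?thesis unfolding mult_sidon_def by auto
qed

lemma progression_meets_interval:
  fixes s :: nat and x :: real
  assumes "s \<ge> 1" "x \<ge> 1"
  obtains k :: nat where "x \<le> real (k * s + 1)" "real (k * s + 1) \<le> x + real s"
proof
  \<comment> \<open>This picks the first term that is at least \<open>x\<close>;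
    \<open>x \<ge> 1\<close> makes the ceiling nonnegative, so \<open>nat\<close> does not change
    it.\<close>
  define k where "k = nat \<lceil>(x - 1) / s\<rceil>"
  have k: "real k = of_int \<lceil>(x - 1) / s\<rceil>"
    using assms by (simp add: k_def)
  have "(x - 1) / s \<le> real k" "real k < (x - 1) / s + 1"
    unfolding k by linarith+
  then show "x \<le> real (k * s + 1)" "real (k * s + 1) \<le> x + real s"
    using assms by (auto simp: field_simps)
qed

theorem theorem1p3:
  fixes n :: nat
  assumes "n \<ge> 1"
  shows "g n \<le> real_of_int \<lfloor>sqrt (real n)\<rfloor>"
proof -
  define s where "s = nat \<lfloor>sqrt (real n)\<rfloor>"
  have s_real: "real_of_int \<lfloor>sqrt (real n)\<rfloor> = real s"
    by (simp add: s_def)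
  have s: "s \<ge> 1"
    using assms by (simp add: s_def le_nat_iff le_floor_iff)
  have "sqrt (real n) < real (s + 1)"
    using s_real by linarith
  then have "real n < (real (s + 1))\<^sup>2"
    using real_sqrt_less_iff[of "real n" "(real (s + 1))\<^sup>2"] by simp
  then have n: "n < (s + 1)\<^sup>2"
    by (simp only: of_nat_less_iff flip: of_nat_power)
  define A where "A = {a. a \<le> n \<and> (\<exists>k. a = k * s + 1)}"
  have sidon: "mult_sidon A"
    unfolding A_def by (rule progression_mult_sidon[OF s n])
  have sub: "A \<subseteq> {1..n}"
    by (auto simp: A_def)
  have meets: "real ` A \<inter> {x..x + real s} \<noteq> {}" if "{x..x + real s} \<subseteq> {1..real n}" for x
  proof -
    \<comment> \<open>The interval is nonempty, so both of its endpoints lie in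
      \<open>{1..real n}\<close>.\<close>
    have x: "x \<ge> 1" "x + real s \<le> real n"
      using that by auto
    obtain k where k: "x \<le> real (k * s + 1)" "real (k * s + 1) \<le> x + real s"
      using progression_meets_interval[OF s x(1)] .
    then have "real (k * s + 1) \<le> real n"
      using x(2) by linarith
    then have "k * s + 1 \<in> A"
      unfolding A_def of_nat_le_iff by blast
    then have "real (k * s + 1) \<in> real ` A \<inter> {x..x + real s}"
      using k by (intro IntI imageI) simp_all
    then show ?thesis by blast
  qed
  show ?thesis
    unfolding g_def s_real
  \<comment> \<open>\<open>real s\<close> is an admissible \<open>L\<close>, witnessed by
    \<open>A\<close>; the infimum of reals also needs the lower bound 0.\<close>
  proof (rule cInf_lower)
    show "bdd_below {L::real. 0 \<le> L \<and> (\<exists>A. mult_sidon A \<and> A \<subseteq> {1..n} \<and>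
        (\<forall>x. {x..x + L} \<subseteq> {1..real n} \<longrightarrow> real ` A \<inter> {x..x + L} \<noteq> {}))}"
      by (rule bdd_belowI[of _ 0]) auto
  qed (use sidon sub meets in auto)
qed

end
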